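(* Let $I=\mathfrak{q}_1 \cap \cdots \cap \mathfrak{q}_r$ be an irreducible decomposition of a monomial ideal $I\subset S=\mathbb{K}[x_1,\ldots,x_n]$. If $t=\max\{\mathrm{sat}(\mathfrak{q}_i) : i=1, \ldots , r\}$, then: (a) $\mathrm{sat}(I) \leq t$. (b) $\mathrm{sat}(I)= t$ if and only if $I$ is an $\mathfrak{m}$-primary monomial ideal.
   Context: $\mathbb{K}$ is a field, $S=\mathbb{K}[x_1,\ldots,x_n]$ is the polynomial ring and $\mathfrak{m}=(x_1,\ldots,x_n)$. For ideals $I,J$ of $S$, $I\colon J=\{f\in S : fJ\subseteq I\}$, and $\mathfrak{m}^0=S$. The saturation number of an ideal $I\subset S$ is $\mathrm{sat}(I)=\min\{k\geq 0 : I\colon\mathfrak{m}^k=I\colon\mathfrak{m}^{k+1}\}$. A monomial ideal is irreducible if and only if it has the form $(x_{i_1}^{c_1},\ldots,x_{i_p}^{c_p})$ with all $c_j>0$. An irreducible decomposition of a monomial ideal $I$ is an expression $I=\mathfrak{q}_1\cap\cdots\cap\mathfrak{q}_r$ with every $\mathfrak{q}_i$ an irreducible monomial ideal.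
   Formalization: Part (b) is proved as "sat(I) = t and t > 0 if and only if I is m-primary"; without t > 0 it is false: for I = q_1 = (x_1) in K[x_1,x_2], sat(I) = t = 0 but I is not m-primary. It fails in this way whenever t = 0. *)

theory Defs
  imports Complex_Main "HOL-Library.Poly_Mapping"
begin

text \<open>
  The polynomial ring \<open>K[x\<^sub>1, \<dots>, x\<^sub>n]\<close> is the monoid algebra of the exponent vectors: a polynomial
  maps each exponent vector \<open>'n \<Rightarrow>\<^sub>0 nat\<close> to its coefficient, and the library's product on
  \<open>\<Rightarrow>\<^sub>0\<close> is convolution.  The finite, non-empty type \<open>'n\<close> indexes the variables, so \<open>n = CARD('n)\<close>.
\<close>

type_synonym ('n, 'k) mpoly = "('n \<Rightarrow>\<^sub>0 nat) \<Rightarrow>\<^sub>0 'k"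

definition monomial :: "('n \<Rightarrow>\<^sub>0 nat) \<Rightarrow> ('n, 'k::zero_neq_one) mpoly" where
  "monomial m = Poly_Mapping.single m 1"

definition var :: "'n \<Rightarrow> ('n, 'k::zero_neq_one) mpoly" where
  "var i = monomial (Poly_Mapping.single i 1)"


text \<open>The ideals of a commutative ring are its submodules as a module over itself.\<close>

lemma module_mult: "module ((*) :: 'a::comm_ring_1 \<Rightarrow> 'a \<Rightarrow> 'a)"
  by (simp add: module_def algebra_simps)

definition is_ideal :: "'a::comm_ring_1 set \<Rightarrow> bool" where
  "is_ideal = module.subspace (*)"

definition ideal_gen :: "'a::comm_ring_1 set \<Rightarrow> 'a set" where
  "ideal_gen = module.span (*)"

definition ideal_mult :: "'a::comm_ring_1 set \<Rightarrow> 'a set \<Rightarrow> 'a set" where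
  "ideal_mult I J = ideal_gen {a * b | a b. a \<in> I \<and> b \<in> J}"

primrec ideal_pow :: "'a::comm_ring_1 set \<Rightarrow> nat \<Rightarrow> 'a set" where
  "ideal_pow I 0 = UNIV"
| "ideal_pow I (Suc k) = ideal_mult I (ideal_pow I k)"

definition colon :: "'a::comm_ring_1 set \<Rightarrow> 'a set \<Rightarrow> 'a set" where
  "colon I J = {f. \<forall>g\<in>J. f * g \<in> I}"

definition radical :: "'a::comm_ring_1 set \<Rightarrow> 'a set" where
  "radical I = {f. \<exists>k. f ^ k \<in> I}"

definition primary_ideal :: "'a::comm_ring_1 set \<Rightarrow> bool" where
  "primary_ideal I \<longleftrightarrow> is_ideal I \<and> I \<noteq> UNIV \<and>
     (\<forall>a b. a * b \<in> I \<longrightarrow> a \<in> I \<or> b \<in> radical I)"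


definition max_ideal :: "('n, 'k::field) mpoly set" where
  "max_ideal = ideal_gen {var i | i. True}"

definition m_primary :: "('n, 'k::field) mpoly set \<Rightarrow> bool" where
  "m_primary I \<longleftrightarrow> primary_ideal I \<and> radical I = max_ideal"

text \<open>For \<open>'n\<close> finite the ring is Noetherian, so for an ideal \<open>I\<close> the minimum is attained.\<close>

definition sat :: "('n, 'k::field) mpoly set \<Rightarrow> nat" where
  "sat I = (LEAST k. colon I (ideal_pow max_ideal k) = colon I (ideal_pow max_ideal (k + 1)))"

definition monomial_ideal :: "('n, 'k::field) mpoly set \<Rightarrow> bool" where
  "monomial_ideal I \<longleftrightarrow> (\<exists>M. I = ideal_gen (monomial ` M))"

text \<open>
  Irreducible monomial ideals are those generated by positive powers of a set of variables.  The
  set may be empty: the zero ideal is irreducible.  The unit ideal is not.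
\<close>

definition irreducible_monomial_ideal :: "('n, 'k::field) mpoly set \<Rightarrow> bool" where
  "irreducible_monomial_ideal Q \<longleftrightarrow>
     (\<exists>A c. (\<forall>i\<in>A. 0 < c i) \<and> Q = ideal_gen {var i ^ c i | i. i \<in> A})"

text \<open>
  A decomposition into \<open>r \<ge> 1\<close> components, indexed by \<open>1, \<dots>, r\<close>; it need not be irredundant.
\<close>

definition irreducible_decomposition ::
    "('n, 'k::field) mpoly set \<Rightarrow> nat \<Rightarrow> (nat \<Rightarrow> ('n, 'k) mpoly set) \<Rightarrow> bool" where
  "irreducible_decomposition I r q \<longleftrightarrow>
     1 \<le> r \<and> (\<forall>i\<in>{1..r}. irreducible_monomial_ideal (q i)) \<and> I = (\<Inter>i\<in>{1..r}. q i)"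

end

theory Submission
  imports Defs
begin

text \<open>
  Every ideal involved consists of the polynomials whose exponent vectors lie in some upward closed
  set \<open>U\<close>, and \<open>I : m^k\<close> corresponds to the set \<open>U\<^sub>k\<close> of those \<open>m\<close> with \<open>m + v \<in> U\<close> for all \<open>v\<close> of
  degree at least \<open>k\<close>.  This operation commutes with intersections, and once \<open>U\<^sub>k = U\<^sub>k\<^sub>+\<^sub>1\<close> the chain
  stays constant, which gives (a).

  A component not involving some variable has \<open>U\<^sub>k = U\<close> for all \<open>k\<close>, so its saturation number is \<open>0\<close>.
  A component \<open>(x\<^sub>1^c\<^sub>1, \<dots>, x\<^sub>n^c\<^sub>n)\<close> with \<open>s = \<Sum> (c\<^sub>i - 1)\<close> has \<open>0 \<notin> U\<^sub>s\<close>, all \<open>m \<noteq> 0\<close> in \<open>U\<^sub>s\<close>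
  and \<open>0 \<in> U\<^sub>s\<^sub>+\<^sub>1\<close>, so its saturation number is \<open>s + 1\<close>.  If some component misses a variable, then
  \<open>0\<close> never enters \<open>U\<^sub>k\<close> for the intersection, and the chain of \<open>I\<close> is stationary already from
  \<open>t - 1\<close> on; if none does, then \<open>0\<close> enters exactly at step \<open>t\<close>.
\<close>

interpretation ideal: module "(*) :: 'a::comm_ring_1 \<Rightarrow> 'a \<Rightarrow> 'a"
  by (rule module_mult)

section \<open>Ideals determined by sets of exponent vectors\<close>

text \<open>Meant for upward closed \<open>U\<close>, where this is the monomial ideal with exponent
  set \<open>U\<close>; intersections and colons become conditions on exponents.\<close>

definition supported_on :: "('n \<Rightarrow>\<^sub>0 nat) set \<Rightarrow> ('n, 'k::field) mpoly set" where
  "supported_on U = {f. Poly_Mapping.keys f \<subseteq> U}"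

definition up_closed :: "('n \<Rightarrow>\<^sub>0 nat) set \<Rightarrow> bool" where
  "up_closed U \<longleftrightarrow> (\<forall>m\<in>U. \<forall>v. m + v \<in> U)"

definition total_degree :: "('n::finite \<Rightarrow>\<^sub>0 nat) \<Rightarrow> nat" where
  "total_degree m = (\<Sum>i\<in>UNIV. Poly_Mapping.lookup m i)"

definition colon_exponents :: "('n::finite \<Rightarrow>\<^sub>0 nat) set \<Rightarrow> nat \<Rightarrow> ('n \<Rightarrow>\<^sub>0 nat) set" where
  "colon_exponents U k = {m. \<forall>v. k \<le> total_degree v \<longrightarrow> m + v \<in> U}"

lemma total_degree_add: "total_degree (m + v) = total_degree m + total_degree v"
  by (simp add: total_degree_def lookup_add sum.distrib)

lemma total_degree_single [simp]: "total_degree (Poly_Mapping.single i c) = c"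
  by (simp add: total_degree_def lookup_single when_def)

lemma total_degree_0_iff [simp]: "total_degree m = 0 \<longleftrightarrow> m = 0"
  by (auto simp: total_degree_def intro!: poly_mapping_eqI)

lemma obtain_single_summand:
  fixes m :: "'n \<Rightarrow>\<^sub>0 nat"
  assumes "c \<le> Poly_Mapping.lookup m i"
  obtains m' where "m = Poly_Mapping.single i c + m'"
proof
  show "m = Poly_Mapping.single i c + (m - Poly_Mapping.single i c)"
    using assms
    by (intro poly_mapping_eqI) (auto simp: lookup_add lookup_minus lookup_single when_def)
qed

lemma obtain_degree_pred:
  assumes "Suc k \<le> total_degree m"
  obtains i m' where "m = Poly_Mapping.single i 1 + m'" "k \<le> total_degree m'"
proof -
  from assms have "m \<noteq> 0" using total_degree_0_iff[of m] by linarith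
  then obtain i where "Poly_Mapping.lookup m i \<noteq> 0" using poly_mapping_eqI[of m 0] by auto
  then obtain m' where m: "m = Poly_Mapping.single i 1 + m'"
    using obtain_single_summand[of 1 m i] by auto
  then show ?thesis using that assms by (simp add: total_degree_add)
qed

lemma sum_monomials:
  "(f :: ('n, 'k::field) mpoly)
     = (\<Sum>m\<in>Poly_Mapping.keys f. Poly_Mapping.single m (Poly_Mapping.lookup f m))"
  by (rule poly_mapping_eqI)
    (simp add: lookup_sum lookup_single when_def in_keys_iff)

text \<open>Shifting exponents by \<open>v\<close> is injective, so no terms cancel.\<close>

lemma lookup_mult_monomial:
  fixes f :: "('n, 'k::field) mpoly"
  shows "Poly_Mapping.lookup (f * monomial v) (m + v) = Poly_Mapping.lookup f m"
proof -
  have "f * monomial v = (\<Sum>a\<in>Poly_Mapping.keys f. Poly_Mapping.single (a + v) (Poly_Mapping.lookup f a))"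
    using arg_cong[OF sum_monomials[of f], of "\<lambda>g. g * monomial v"]
    by (simp add: sum_distrib_right monomial_def mult_single)
  then show ?thesis
    by (simp add: lookup_sum lookup_single when_def in_keys_iff)
qed

lemma monomial_mem_supported_on [simp]:
  "(monomial m :: ('n, 'k::field) mpoly) \<in> supported_on U \<longleftrightarrow> m \<in> U"
  by (simp add: supported_on_def monomial_def)

lemma single_mem_supported_on:
  "m \<in> U \<Longrightarrow> Poly_Mapping.single m c \<in> supported_on U"
  by (simp add: supported_on_def)

lemma supported_on_eq_iff [simp]:
  "(supported_on U :: ('n, 'k::field) mpoly set) = supported_on V \<longleftrightarrow> U = V"
  by (metis monomial_mem_supported_on subsetI subset_antisym)

lemma supported_on_INT: "supported_on (\<Inter>i\<in>A. U i) = (\<Inter>i\<in>A. supported_on (U i))"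
  by (auto simp: supported_on_def)

lemma mult_mem_supported_on:
  assumes "f \<in> supported_on U" "g \<in> supported_on V"
    and "\<And>m v. m \<in> U \<Longrightarrow> v \<in> V \<Longrightarrow> m + v \<in> W"
  shows "f * g \<in> supported_on W"
  using assms keys_mult[of f g] unfolding supported_on_def by blast

lemma subspace_supported_on:
  assumes "up_closed U"
  shows "ideal.subspace (supported_on U :: ('n, 'k::field) mpoly set)"
proof (rule ideal.subspaceI)
  show "(0 :: ('n, 'k) mpoly) \<in> supported_on U" by (simp add: supported_on_def)
  show "x + y \<in> supported_on U" if "x \<in> supported_on U" "y \<in> supported_on U"
    for x y :: "('n, 'k) mpoly"
    using that keys_add[of x y] by (auto simp: supported_on_def)
  show "c * x \<in> supported_on U" if "x \<in> supported_on U" for c x :: "('n, 'k) mpoly"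
    using assms that mult_mem_supported_on[of x U c UNIV U]
    by (auto simp: up_closed_def mult.commute supported_on_def)
qed

text \<open>A polynomial is the finite sum of its terms, so only single terms have to be generated.
  This criterion identifies \<open>max_ideal\<close>, its powers and the irreducible ideals.\<close>

lemma supported_on_eq_ideal_gen:
  assumes "up_closed U" and "G \<subseteq> supported_on U"
    and "\<And>m (c :: 'k::field). m \<in> U \<Longrightarrow> Poly_Mapping.single m c \<in> ideal_gen G"
  shows "ideal_gen G = (supported_on U :: ('n, 'k) mpoly set)"
proof
  show "ideal_gen G \<subseteq> supported_on U"
    unfolding ideal_gen_def by (rule ideal.span_minimal[OF assms(2) subspace_supported_on[OF assms(1)]])
  show "supported_on U \<subseteq> ideal_gen G"
  proof
    fix f :: "('n, 'k) mpoly"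
    assume f: "f \<in> supported_on U"
    have "(\<Sum>m\<in>Poly_Mapping.keys f. Poly_Mapping.single m (Poly_Mapping.lookup f m)) \<in> ideal_gen G"
      unfolding ideal_gen_def
      by (rule ideal.span_sum, fold ideal_gen_def) (use f assms(3) in \<open>auto simp: supported_on_def\<close>)
    then show "f \<in> ideal_gen G" by (simp flip: sum_monomials)
  qed
qed

section \<open>Powers of the maximal ideal and colons by them\<close>

lemma var_power: "var i ^ c = (monomial (Poly_Mapping.single i c) :: ('n, 'k::field) mpoly)"
  by (induction c) (simp_all add: var_def monomial_def mult_single flip: single_add)

lemma up_closed_total_degree_ge: "up_closed {m. k \<le> total_degree m}"
  by (simp add: up_closed_def total_degree_add)

lemma max_ideal_eq_supported_on:
  "max_ideal = (supported_on {m. 1 \<le> total_degree m} :: ('n::finite, 'k::field) mpoly set)"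
  unfolding max_ideal_def
proof (rule supported_on_eq_ideal_gen[OF up_closed_total_degree_ge])
  show "{var i | i. True} \<subseteq> (supported_on {m. 1 \<le> total_degree m} :: ('n, 'k) mpoly set)"
    by (auto simp: var_def)
  fix m :: "'n \<Rightarrow>\<^sub>0 nat" and c :: 'k
  assume "m \<in> {m. 1 \<le> total_degree m}"
  then obtain i m' where "m = Poly_Mapping.single i 1 + m'"
    using obtain_degree_pred[of 0 m] by auto
  then have "Poly_Mapping.single m c = Poly_Mapping.single m' c * (var i :: ('n, 'k) mpoly)"
    by (simp add: var_def monomial_def mult_single add.commute)
  moreover have "var i \<in> ideal_gen ({var i | i. True} :: ('n, 'k) mpoly set)"
    unfolding ideal_gen_def by (rule ideal.span_base) auto
  ultimately show "Poly_Mapping.single m c \<in> ideal_gen {var i | i. True}"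
    by (simp add: ideal_gen_def ideal.span_scale)
qed

lemma ideal_pow_max_ideal:
  "ideal_pow max_ideal k = (supported_on {m. k \<le> total_degree m} :: ('n::finite, 'k::field) mpoly set)"
proof (induction k)
  case 0
  show ?case by (simp add: supported_on_def)
next
  case (Suc k)
  let ?G = "{a * b | a b. a \<in> max_ideal \<and> b \<in> ideal_pow max_ideal k} :: ('n, 'k) mpoly set"
  have "ideal_gen ?G = supported_on {m. Suc k \<le> total_degree m}"
  proof (rule supported_on_eq_ideal_gen[OF up_closed_total_degree_ge])
    show "?G \<subseteq> supported_on {m. Suc k \<le> total_degree m}"
      using mult_mem_supported_on[of _ "{m. 1 \<le> total_degree m}" _ "{m. k \<le> total_degree m}"
        "{m. Suc k \<le> total_degree m}"]
      unfolding Suc unfolding max_ideal_eq_supported_on by (fastforce simp: total_degree_add)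
    fix m :: "'n \<Rightarrow>\<^sub>0 nat" and c :: 'k
    assume "m \<in> {m. Suc k \<le> total_degree m}"
    then obtain i m' where m: "m = Poly_Mapping.single i 1 + m'" "k \<le> total_degree m'"
      using obtain_degree_pred[of k m] by auto
    have "Poly_Mapping.single m c = var i * Poly_Mapping.single m' c"
      by (simp add: m var_def monomial_def mult_single)
    moreover have "var i \<in> (max_ideal :: ('n, 'k) mpoly set)"
      by (simp add: max_ideal_eq_supported_on var_def)
    moreover have "Poly_Mapping.single m' c \<in> ideal_pow max_ideal k"
      using m by (simp add: Suc single_mem_supported_on)
    ultimately show "Poly_Mapping.single m c \<in> ideal_gen ?G"
      unfolding ideal_gen_def by (blast intro!: ideal.span_base)
  qed
  then show ?case by (simp add: ideal_mult_def)
qed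

text \<open>The monomials of \<open>m^k\<close> already detect the colon ideal, since multiplying by
  one shifts the support without cancellation. Conversely, the keys of a product are sums of
  keys.\<close>

lemma colon_max_ideal_pow:
  "colon (supported_on U) (ideal_pow max_ideal k)
     = (supported_on (colon_exponents U k) :: ('n::finite, 'k::field) mpoly set)"
proof (intro equalityI subsetI)
  fix f :: "('n, 'k) mpoly"
  assume f: "f \<in> colon (supported_on U) (ideal_pow max_ideal k)"
  have "m + v \<in> U" if "m \<in> Poly_Mapping.keys f" "k \<le> total_degree v" for m v
  proof -
    have "f * monomial v \<in> supported_on U"
      using f that by (simp add: colon_def ideal_pow_max_ideal)
    moreover have "m + v \<in> Poly_Mapping.keys (f * monomial v)"
      using that by (simp add: in_keys_iff lookup_mult_monomial)
    ultimately show ?thesis by (auto simp: supported_on_def)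
  qed
  then show "f \<in> supported_on (colon_exponents U k)"
    by (auto simp: supported_on_def colon_exponents_def)
next
  fix f :: "('n, 'k) mpoly"
  assume "f \<in> supported_on (colon_exponents U k)"
  then show "f \<in> colon (supported_on U) (ideal_pow max_ideal k)"
    by (auto simp: colon_def ideal_pow_max_ideal colon_exponents_def intro: mult_mem_supported_on)
qed

section \<open>Saturation numbers in terms of exponent vectors\<close>

lemma colon_exponents_mono: "j \<le> k \<Longrightarrow> colon_exponents U j \<subseteq> colon_exponents U k"
  by (auto simp: colon_exponents_def)

text \<open>The exponent form of \<open>I : m^(k+1) = (I : m^k) : m\<close>. Each set is determined
  by the one before, so the chain cannot move again after a repetition.\<close>

lemma colon_exponents_Suc:
  "colon_exponents U (Suc k) = {m. \<forall>i. m + Poly_Mapping.single i 1 \<in> colon_exponents U k}"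
proof (intro equalityI subsetI)
  fix m assume "m \<in> colon_exponents U (Suc k)"
  then show "m \<in> {m. \<forall>i. m + Poly_Mapping.single i 1 \<in> colon_exponents U k}"
    by (auto simp: colon_exponents_def add.assoc total_degree_add)
next
  fix m assume m: "m \<in> {m. \<forall>i. m + Poly_Mapping.single i 1 \<in> colon_exponents U k}"
  have "m + v \<in> U" if "Suc k \<le> total_degree v" for v
  proof -
    from that obtain i v' where "v = Poly_Mapping.single i 1 + v'" "k \<le> total_degree v'"
      by (rule obtain_degree_pred)
    with m show ?thesis by (auto simp: colon_exponents_def add.assoc)
  qed
  then show "m \<in> colon_exponents U (Suc k)" by (simp add: colon_exponents_def)
qed

lemma colon_exponents_stable:
  assumes "colon_exponents U k = colon_exponents U (Suc k)" and "k \<le> l"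
  shows "colon_exponents U l = colon_exponents U k"
  using assms(2)
proof (induction l rule: dec_induct)
  case base
  show ?case ..
next
  case (step l)
  then have "colon_exponents U (Suc l) = colon_exponents U (Suc k)"
    by (simp only: colon_exponents_Suc)
  then show ?case using assms(1) by simp
qed

lemma sat_supported_on:
  "sat (supported_on U :: ('n::finite, 'k::field) mpoly set)
     = (LEAST k. colon_exponents U k = colon_exponents U (Suc k))"
  by (simp add: sat_def colon_max_ideal_pow del: ideal_pow.simps)

lemma sat_supported_on_le:
  assumes "colon_exponents U k = colon_exponents U (Suc k)"
  shows "sat (supported_on U :: ('n::finite, 'k::field) mpoly set) \<le> k"
  unfolding sat_supported_on by (rule Least_le) (rule assms)

text \<open>The stationary step \<open>k\<close> ensures that the \<open>LEAST\<close> in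
  \<open>sat\<close> is attained; it stands in for Noetherianity.\<close>

lemma colon_exponents_sat:
  assumes "colon_exponents U k = colon_exponents U (Suc k)"
    and "sat (supported_on U :: ('n::finite, 'k::field) mpoly set) \<le> l"
  shows "colon_exponents U l = colon_exponents U (sat (supported_on U :: ('n, 'k) mpoly set))"
proof (rule colon_exponents_stable[OF _ assms(2)])
  show "colon_exponents U (sat (supported_on U :: ('n, 'k) mpoly set))
      = colon_exponents U (Suc (sat (supported_on U :: ('n, 'k) mpoly set)))"
    unfolding sat_supported_on by (rule LeastI) (rule assms(1))
qed

lemma colon_exponents_INT: "colon_exponents (\<Inter>i\<in>A. U i) k = (\<Inter>i\<in>A. colon_exponents (U i) k)"
  by (auto simp: colon_exponents_def)

section \<open>Irreducible monomial ideals\<close>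

definition irr_exponents :: "'n set \<Rightarrow> ('n \<Rightarrow> nat) \<Rightarrow> ('n \<Rightarrow>\<^sub>0 nat) set" where
  "irr_exponents A c = {m. \<exists>i\<in>A. c i \<le> Poly_Mapping.lookup m i}"

lemma up_closed_irr_exponents: "up_closed (irr_exponents A c)"
  by (fastforce simp: up_closed_def irr_exponents_def lookup_add intro: trans_le_add1)

lemma ideal_gen_var_powers:
  "ideal_gen {var i ^ c i | i. i \<in> A} = (supported_on (irr_exponents A c) :: ('n, 'k::field) mpoly set)"
proof (rule supported_on_eq_ideal_gen[OF up_closed_irr_exponents])
  show "{var i ^ c i | i. i \<in> A} \<subseteq> (supported_on (irr_exponents A c) :: ('n, 'k) mpoly set)"
    by (force simp: var_power irr_exponents_def)
  fix m :: "'n \<Rightarrow>\<^sub>0 nat" and d :: 'k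
  assume "m \<in> irr_exponents A c"
  then obtain i where i: "i \<in> A" "c i \<le> Poly_Mapping.lookup m i"
    by (auto simp: irr_exponents_def)
  then obtain m' where "m = Poly_Mapping.single i (c i) + m'"
    using obtain_single_summand[of "c i" m i] by auto
  then have "Poly_Mapping.single m d = Poly_Mapping.single m' d * (var i ^ c i :: ('n, 'k) mpoly)"
    by (simp add: var_power monomial_def mult_single add.commute)
  moreover have "var i ^ c i \<in> ideal_gen ({var i ^ c i | i. i \<in> A} :: ('n, 'k) mpoly set)"
    unfolding ideal_gen_def using i by (intro ideal.span_base) auto
  ultimately show "Poly_Mapping.single m d \<in> ideal_gen {var i ^ c i | i. i \<in> A}"
    by (simp add: ideal_gen_def ideal.span_scale)
qed

lemma zero_notin_irr_exponents:
  "\<forall>i\<in>A. 0 < c i \<Longrightarrow> 0 \<notin> irr_exponents A c"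
  by (auto simp: irr_exponents_def)

text \<open>A power of a variable outside \<open>A\<close> can have any prescribed degree and never
  decides membership.\<close>

lemma colon_irr_exponents_missing:
  fixes A :: "'n::finite set"
  assumes "A \<noteq> UNIV"
  shows "colon_exponents (irr_exponents A c) k = irr_exponents A c"
proof (intro equalityI subsetI)
  fix m assume m: "m \<in> colon_exponents (irr_exponents A c) k"
  from assms obtain j where "j \<notin> A" by auto
  moreover have "m + Poly_Mapping.single j k \<in> irr_exponents A c"
    using m by (simp add: colon_exponents_def)
  ultimately show "m \<in> irr_exponents A c"
    by (fastforce simp: irr_exponents_def lookup_add lookup_single when_def split: if_splits)
next
  fix m assume "m \<in> irr_exponents A c"
  then show "m \<in> colon_exponents (irr_exponents A c) k"
    using up_closed_irr_exponents[of A c] by (simp add: up_closed_def colon_exponents_def)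
qed

text \<open>For positive \<open>c\<close>, the degree of the monomial with exponents
  \<open>c i - 1\<close>, which spans the socle modulo the ideal generated by all
  \<open>var i ^ c i\<close>.\<close>

definition socle_degree :: "('n::finite \<Rightarrow> nat) \<Rightarrow> nat" where
  "socle_degree c = (\<Sum>i\<in>UNIV. c i - 1)"

text \<open>Pigeonhole: outside the set each exponent is at most \<open>c i - 1\<close>, which
  bounds the degree.\<close>

lemma irr_exponents_large_degree:
  fixes m :: "'n::finite \<Rightarrow>\<^sub>0 nat"
  assumes "socle_degree c < total_degree m"
  shows "m \<in> irr_exponents UNIV c"
proof (rule ccontr)
  assume "m \<notin> irr_exponents UNIV c"
  then have less: "Poly_Mapping.lookup m i < c i" for i by (simp add: irr_exponents_def not_le)
  have "Poly_Mapping.lookup m i \<le> c i - 1" for i using less[of i] by linarith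
  then have "total_degree m \<le> socle_degree c"
    unfolding total_degree_def socle_degree_def by (rule sum_mono)
  with assms show False by simp
qed

text \<open>At \<open>k = socle_degree c\<close> only the exponent \<open>0\<close> is still absent,
  and one step later nothing is. This delay separates \<open>t - 1\<close> from \<open>t\<close> in
  the theorem.\<close>

lemma colon_irr_exponents_full:
  fixes c :: "'n::finite \<Rightarrow> nat"
  assumes "\<forall>i. 0 < c i"
  shows "0 \<in> colon_exponents (irr_exponents UNIV c) k \<longleftrightarrow> socle_degree c < k"
    and "m \<noteq> 0 \<Longrightarrow> socle_degree c \<le> k \<Longrightarrow> m \<in> colon_exponents (irr_exponents UNIV c) k"
    and "socle_degree c < k \<Longrightarrow> colon_exponents (irr_exponents UNIV c) k = UNIV"
proof -
  show 1: "colon_exponents (irr_exponents UNIV c) k = UNIV" if "socle_degree c < k" for k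
    using that by (auto simp: colon_exponents_def total_degree_add intro!: irr_exponents_large_degree)
  show "m \<in> colon_exponents (irr_exponents UNIV c) k" if "m \<noteq> 0" "socle_degree c \<le> k"
  proof -
    \<comment> \<open>A nonzero \<open>m\<close> adds at least one to the degree of
      \<open>v\<close>, so \<open>m + v\<close> exceeds the bound already at
      \<open>k = socle_degree c\<close>.\<close>
    have "0 < total_degree m" using that(1) by (metis total_degree_0_iff neq0_conv)
    then show ?thesis using that(2)
      by (auto simp: colon_exponents_def total_degree_add intro!: irr_exponents_large_degree)
  qed
  show "0 \<in> colon_exponents (irr_exponents UNIV c) k \<longleftrightarrow> socle_degree c < k"
  proof
    assume z: "0 \<in> colon_exponents (irr_exponents UNIV c) k"
    \<comment> \<open>The exponent of the socle monomial: it avoids the ideal and has degree exactly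
      \<open>socle_degree c\<close>.\<close>
    define w where "w = (\<Sum>i\<in>UNIV. Poly_Mapping.single i (c i - 1))"
    have w: "Poly_Mapping.lookup w i = c i - 1" for i
      by (simp add: w_def lookup_sum lookup_single when_def)
    have "w \<notin> irr_exponents UNIV c"
      using assms by (auto simp: irr_exponents_def w not_le)
    with z have "\<not> k \<le> total_degree w" by (auto simp: colon_exponents_def)
    then show "socle_degree c < k" by (simp add: total_degree_def socle_degree_def w)
  qed (simp add: 1)
qed

text \<open>Supplies, for each component, the stationary step that
  \<open>colon_exponents_sat\<close> requires.\<close>

lemma colon_irr_exponents_stationary:
  fixes A :: "'n::finite set"
  assumes "\<forall>i\<in>A. 0 < c i"
  shows "\<exists>k. colon_exponents (irr_exponents A c) k = colon_exponents (irr_exponents A c) (Suc k)"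
proof (cases "A = UNIV")
  case True
  then show ?thesis using assms
    by (intro exI[of _ "Suc (socle_degree c)"]) (simp add: colon_irr_exponents_full(3))
next
  case False
  then show ?thesis by (simp add: colon_irr_exponents_missing)
qed

lemma sat_irr_full:
  fixes c :: "'n::finite \<Rightarrow> nat"
  assumes c: "\<forall>i. 0 < c i"
  shows "sat (supported_on (irr_exponents UNIV c) :: ('n, 'k::field) mpoly set) = Suc (socle_degree c)"
    (is "sat ?Q = _")
proof (rule antisym)
  have eq: "colon_exponents (irr_exponents UNIV c) (Suc (socle_degree c))
      = colon_exponents (irr_exponents UNIV c) (Suc (Suc (socle_degree c)))"
    by (simp add: colon_irr_exponents_full(3)[OF c])
  then show le: "sat ?Q \<le> Suc (socle_degree c)" by (rule sat_supported_on_le)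
  \<comment> \<open>Lower bound: the set at \<open>sat ?Q\<close> is already everything, whereas
    \<open>0\<close> enters only beyond \<open>socle_degree c\<close>.\<close>
  have "colon_exponents (irr_exponents UNIV c) (sat ?Q) = UNIV"
    using colon_exponents_sat[OF eq le] colon_irr_exponents_full(3)[OF c lessI] by simp
  then have "0 \<in> colon_exponents (irr_exponents UNIV c) (sat ?Q)" by simp
  then show "Suc (socle_degree c) \<le> sat ?Q"
    by (simp add: colon_irr_exponents_full(1)[OF c] Suc_le_eq)
qed

lemma sat_irr_missing:
  fixes A :: "'n::finite set"
  assumes "A \<noteq> UNIV"
  shows "sat (supported_on (irr_exponents A c) :: ('n, 'k::field) mpoly set) = 0"
proof -
  have "colon_exponents (irr_exponents A c) 0 = colon_exponents (irr_exponents A c) (Suc 0)"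
    by (simp only: colon_irr_exponents_missing[OF assms])
  from sat_supported_on_le[OF this] show ?thesis by (simp only: le_zero_eq)
qed

section \<open>Primary ideals with radical the maximal ideal\<close>

lemma power_mem_ideal_pow:
  fixes f :: "('n::finite, 'k::field) mpoly"
  assumes "f \<in> max_ideal"
  shows "f ^ k \<in> ideal_pow max_ideal k"
proof (induction k)
  case (Suc k)
  then show ?case using assms
    unfolding ideal_pow.simps ideal_mult_def ideal_gen_def power_Suc
    by (intro ideal.span_base) blast
qed simp

text \<open>Properness comes from \<open>z\<close>, and \<open>large\<close> puts the
  \<open>N\<close>-th power of every element of \<open>max_ideal\<close> into the ideal. Cancelling
  factors outside \<open>max_ideal\<close> then gives both the primary condition and the upper bound
  on the radical.\<close>

lemma m_primary_supported_on:
  fixes U :: "('n::finite \<Rightarrow>\<^sub>0 nat) set"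
  assumes up: "up_closed U" and z: "0 \<notin> U" and large: "\<And>m. N \<le> total_degree m \<Longrightarrow> m \<in> U"
  shows "m_primary (supported_on U :: ('n, 'k::field) mpoly set)"
proof -
  let ?I = "supported_on U :: ('n, 'k) mpoly set"
  note ideal = subspace_supported_on[OF up, where ?'k = 'k]
  have pow: "f ^ N \<in> ?I" if "f \<in> max_ideal" for f
    using power_mem_ideal_pow[OF that, of N] large by (auto simp: ideal_pow_max_ideal supported_on_def)
  have one: "1 \<notin> ?I" using z by (simp add: supported_on_def)
  \<comment> \<open>If \<open>b = \<beta> - h\<close> with \<open>\<beta> \<noteq> 0\<close> constant and \<open>h \<in> m\<close>, then \<open>b\<close> divides \<open>\<beta>^N - h^N\<close> and
    \<open>h^N \<in> I\<close>, so \<open>b\<close> is a unit modulo \<open>I\<close>.\<close>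
  have cancel: "a \<in> ?I" if ab: "a * b \<in> ?I" and b: "b \<notin> max_ideal" for a b
  proof -
    define \<beta> where "\<beta> = Poly_Mapping.lookup b 0"
    define B where "B = (Poly_Mapping.single 0 \<beta> :: ('n, 'k) mpoly)"
    define h where "h = B - b"
    from b have "0 \<in> Poly_Mapping.keys b"
      by (auto simp: max_ideal_eq_supported_on supported_on_def Suc_le_eq intro!: gr0I)
    then have \<beta>: "\<beta> \<noteq> 0" by (simp add: \<beta>_def in_keys_iff)
    have "Poly_Mapping.lookup h 0 = 0" by (simp add: h_def B_def \<beta>_def lookup_minus)
    then have "h \<in> max_ideal"
      by (auto simp: max_ideal_eq_supported_on supported_on_def in_keys_iff Suc_le_eq intro!: gr0I)
    then have hN: "h ^ N \<in> ?I" by (rule pow)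
    define g where "g = (\<Sum>i<N. h ^ (N - Suc i) * B ^ i)"
    have "B ^ N - h ^ N = b * g"
      unfolding power_diff_sumr2 g_def by (simp add: h_def)
    then have "B ^ N = b * g + h ^ N" by (metis diff_add_cancel)
    then have "a * B ^ N = g * (a * b) + a * h ^ N"
      by (simp only: distrib_left mult_ac)
    also have "\<dots> \<in> ?I"
      by (intro ideal.subspace_add[OF ideal] ideal.subspace_scale[OF ideal] ab hN)
    finally have aB: "a * B ^ N \<in> ?I" .
    define C where "C = (Poly_Mapping.single 0 (inverse \<beta>) :: ('n, 'k) mpoly)"
    have "C * B = 1" using \<beta> by (simp add: B_def C_def mult_single)
    then have "C ^ N * B ^ N = 1" by (metis power_mult_distrib power_one)
    then have "C ^ N * (a * B ^ N) = a" by (metis mult.left_commute mult.right_neutral)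
    then show ?thesis using ideal.subspace_scale[OF ideal aB, of "C ^ N"] by simp
  qed
  have "f \<in> max_ideal" if "f ^ k \<in> ?I" for f k
  proof (rule ccontr)
    assume f: "f \<notin> max_ideal"
    \<comment> \<open>Cancelling one factor \<open>f\<close> at a time descends from
      \<open>f ^ k\<close> to \<open>f ^ 0\<close>.\<close>
    from that have "1 \<in> ?I"
    proof (induction k)
      case (Suc k)
      then show ?case using cancel[of "f ^ k" f] f by (simp add: mult.commute)
    qed simp
    with one show False ..
  qed
  then have rad: "radical ?I = max_ideal" using pow by (auto simp: radical_def)
  show ?thesis
    unfolding m_primary_def primary_ideal_def is_ideal_def rad
    using cancel one ideal by auto
qed

text \<open>The conjunct \<open>0 < t\<close> matters: for \<open>t = 0\<close> the equality
  \<open>sat I = t\<close> follows from (a), yet every component misses a variable and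
  \<open>I\<close> is not \<open>m_primary\<close>.\<close>

theorem corollary2p2:
  fixes I :: "('n::finite, 'k::field) mpoly set"
    and q :: "nat \<Rightarrow> ('n, 'k) mpoly set"
    and r t :: nat
  assumes "monomial_ideal I"
    and "irreducible_decomposition I r q"
    and "t = Max {sat (q i) | i. i \<in> {1..r}}"
  shows "sat I \<le> t \<and> (sat I = t \<and> 0 < t \<longleftrightarrow> m_primary I \<and> monomial_ideal I)"
proof -
  from assms(2) have r: "1 \<le> r" and irr: "\<And>i. i \<in> {1..r} \<Longrightarrow> irreducible_monomial_ideal (q i)"
    and I: "I = (\<Inter>i\<in>{1..r}. q i)"
    unfolding irreducible_decomposition_def by auto
  from irr have "\<forall>i\<in>{1..r}. \<exists>A c. (\<forall>j\<in>A. 0 < c j) \<and> q i = supported_on (irr_exponents A c)"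
    unfolding irreducible_monomial_ideal_def ideal_gen_var_powers by blast
  then obtain A c where pos: "\<And>i. i \<in> {1..r} \<Longrightarrow> \<forall>j\<in>A i. 0 < c i j"
    and q: "\<And>i. i \<in> {1..r} \<Longrightarrow> q i = supported_on (irr_exponents (A i) (c i))"
    by metis
  define V where "V i = irr_exponents (A i) (c i)" for i
  define U where "U = (\<Inter>i\<in>{1..r}. V i)"
  have IU: "I = supported_on U"
    using q by (simp add: I U_def V_def supported_on_INT)
  have colU: "colon_exponents U k = (\<Inter>i\<in>{1..r}. colon_exponents (V i) k)" for k
    by (simp add: U_def colon_exponents_INT)
  have sat_le: "sat (q i) \<le> t" if "i \<in> {1..r}" for i
    unfolding assms(3) using that by (intro Max_ge) auto
  have "t \<in> {sat (q i) | i. i \<in> {1..r}}"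
    unfolding assms(3) using r by (intro Max_in) auto
  then obtain i0 where i0: "i0 \<in> {1..r}" "t = sat (q i0)" by auto
  have full: "socle_degree (c i) < t" if "i \<in> {1..r}" "A i = UNIV" for i
    using sat_le[OF that(1)] pos[OF that(1)] that(2)
    by (simp add: q[OF that(1)] sat_irr_full Suc_le_eq)
  \<comment> \<open>\<open>t\<close> is at least the saturation number of every component, so all
    their chains are constant from \<open>t\<close> on; intersecting them gives (a).\<close>
  have stable: "colon_exponents (V i) t = colon_exponents (V i) (Suc t)" if i: "i \<in> {1..r}" for i
  proof -
    obtain k where k: "colon_exponents (V i) k = colon_exponents (V i) (Suc k)"
      using colon_irr_exponents_stationary[OF pos[OF i]] by (auto simp: V_def)
    have "sat (supported_on (V i) :: ('n, 'k) mpoly set) \<le> t"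
      using sat_le[OF i] by (simp add: q[OF i] V_def)
    then show ?thesis using colon_exponents_sat[OF k] by (metis le_SucI)
  qed
  have stableU: "colon_exponents U t = colon_exponents U (Suc t)"
    unfolding colU using stable by auto
  have a: "sat I \<le> t" unfolding IU by (rule sat_supported_on_le[OF stableU])
  have zU: "0 \<notin> U"
    using zero_notin_irr_exponents[OF pos, of i0] i0 by (auto simp: U_def V_def)
  have "m_primary I \<longleftrightarrow> sat I = t \<and> 0 < t"
  proof
    assume "m_primary I"
    then have rad: "radical I = max_ideal" by (simp add: m_primary_def)
    have A: "A i = UNIV" if i: "i \<in> {1..r}" for i
    proof -
      have "j \<in> A i" for j
      proof -
        \<comment> \<open>Some power of \<open>var j\<close> lies in every component; as the
          exponents \<open>c i\<close> are positive, only a generator in the variable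
          \<open>j\<close> itself can divide it.\<close>
        have "var j \<in> radical I"
          by (simp add: rad max_ideal_eq_supported_on var_def)
        then obtain k where "var j ^ k \<in> I" by (auto simp: radical_def)
        then have "Poly_Mapping.single j k \<in> V i"
          using i by (auto simp: IU var_power U_def)
        then show ?thesis using pos[OF i]
          by (fastforce simp: V_def irr_exponents_def lookup_single when_def split: if_splits)
      qed
      then show ?thesis by auto
    qed
    have c0: "\<forall>j. 0 < c i0 j" using pos[OF i0(1)] A[OF i0(1)] by simp
    have t: "t = Suc (socle_degree (c i0))"
      by (simp add: i0(2) q[OF i0(1)] A[OF i0(1)] sat_irr_full[OF c0])
    \<comment> \<open>All socle degrees are below \<open>t\<close>, so \<open>0\<close> is in the
      stable set and hence in the set at \<open>sat I\<close>. The component \<open>i0\<close>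
      attaining the maximum then forces \<open>sat I\<close> up to \<open>t\<close>.\<close>
    have "0 \<in> colon_exponents U t"
      unfolding colU using A pos full by (simp add: V_def colon_irr_exponents_full(1))
    also have "colon_exponents U t = colon_exponents U (sat I)"
      using colon_exponents_sat[OF stableU] a by (simp add: IU)
    finally have "0 \<in> colon_exponents (V i0) (sat I)"
      using i0 by (auto simp: colU)
    then have "socle_degree (c i0) < sat I"
      by (simp add: V_def A[OF i0(1)] colon_irr_exponents_full(1)[OF c0])
    then show "sat I = t \<and> 0 < t" using a t by simp
  next
    assume t: "sat I = t \<and> 0 < t"
    have A: "A i = UNIV" if i: "i \<in> {1..r}" for i
    proof (rule ccontr)
      assume Ai: "A i \<noteq> UNIV"
      have "m \<in> colon_exponents (V j) (t - 1)"
        if m: "m \<in> colon_exponents U t" and j: "j \<in> {1..r}" for m j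
      proof -
        have mV: "m \<in> colon_exponents (V l) t" if "l \<in> {1..r}" for l
          using m that unfolding colU by (rule INT_D)
        show ?thesis
        proof (cases "A j = UNIV")
          case True
          \<comment> \<open>The component \<open>i\<close> keeps its exponent set for all
            \<open>k\<close> and omits \<open>0\<close>. So \<open>m\<close> is nonzero and lies in
            the set of the full component \<open>j\<close> already at \<open>t - 1\<close>.\<close>
          have "m \<in> V i"
            using mV[OF i] unfolding V_def colon_irr_exponents_missing[OF Ai] .
          then have "m \<noteq> 0"
            using zero_notin_irr_exponents[OF pos[OF i]] by (auto simp: V_def)
          moreover have "\<forall>l. 0 < c j l" "socle_degree (c j) \<le> t - 1"
            using pos[OF j] full[OF j True] True by auto
          ultimately show ?thesis
            unfolding V_def True by (intro colon_irr_exponents_full(2))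
        next
          case False
          show ?thesis using mV[OF j] unfolding V_def colon_irr_exponents_missing[OF False] .
        qed
      qed
      then have "colon_exponents U t \<subseteq> colon_exponents U (t - 1)"
        unfolding colU[of "t - 1"] by blast
      \<comment> \<open>Here \<open>0 < t\<close> makes \<open>Suc (t - 1)\<close> equal to
        \<open>t\<close>, so the chain is stationary one step too early.\<close>
      then have "colon_exponents U (t - 1) = colon_exponents U (Suc (t - 1))"
        using colon_exponents_mono[of "t - 1" t U] t by auto
      then have "sat I \<le> t - 1" unfolding IU by (rule sat_supported_on_le)
      with t show False by linarith
    qed
    have "up_closed (V i)" for i by (simp add: V_def up_closed_irr_exponents)
    then have up: "up_closed U" by (simp add: U_def up_closed_def)
    \<comment> \<open>With no variable missing anywhere, \<open>t\<close> exceeds every socle degree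
      and serves as the bound \<open>N\<close>.\<close>
    have large: "m \<in> U" if m: "t \<le> total_degree m" for m
      unfolding U_def
    proof (rule INT_I)
      fix i assume i: "i \<in> {1..r}"
      have "socle_degree (c i) < total_degree m" using full[OF i A[OF i]] m by simp
      then show "m \<in> V i" unfolding V_def A[OF i] by (rule irr_exponents_large_degree)
    qed
    show "m_primary I" unfolding IU by (rule m_primary_supported_on[OF up zU large])
  qed
  with a assms(1) show ?thesis by blast
qed

end
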